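(* Let $f\in C_{rd}(\overline\Omega\times\mathbb{R}^2,\mathbb{R})$, $j\in C_{rd}(\overline\Omega\times I\times\mathbb{R},\mathbb{R})$, and let $\alpha=\alpha(x,z)$, $\beta=\beta(y,z)$ be real-valued rd-continuous functions with $\alpha(x_0,z)=\beta(y_0,z)$ for $z\in I$. Suppose $$|f(x,y,z,u,v)-f(x,y,z,\overline u,\overline v)|\le p_1(x,y,z)\big[|u-\overline u|+|v-\overline v|\big],$$ $$|j(x,y,z,q,u)-j(x,y,z,q,\overline u)|\le p_2(x,y,z,q)|u-\overline u|,$$ for all values of the arguments, where $p_1\in C_{rd}(\overline\Omega,\mathbb{R}_+)$ and $p_2\in C_{rd}(\overline\Omega\times I,\mathbb{R}_+)$, and $$\int_{x_0}^x\int_{y_0}^y\Big[p_1(s,t,z)+\int_a^b p_2(s,t,z,q)\,\Delta q\Big]\Delta t\,\Delta s<\infty$$ for $(x,y,z)\in\overline\Omega$. Then the problem $$u^{\Delta_2\Delta_1}(x,y,z)=f\big(x,y,z,u(x,y,z),(hu)(x,y,z)\big),\qquad (hu)(x,y,z)=\int_a^b j(x,y,z,q,u(x,y,q))\,\Delta q,$$ $$u(x,y_0,z)=\alpha(x,z),\qquad u(x_0,y,z)=\beta(y,z),$$ for $(x,y,z)\in\overline\Omega$, has at most one solution.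
   Context: $\mathbb{T}_1,\mathbb{T}_2$ are time scales (nonempty closed subsets of $\mathbb{R}$) with at least two points, $x_0\in\mathbb{T}_1$, $y_0\in\mathbb{T}_2$, and $\Omega=\{(x,y)\in\mathbb{T}_1\times\mathbb{T}_2: x\ge x_0,\ y\ge y_0\}$. $I=[a,b]$ with $a<b$, and $\overline\Omega=\Omega\times I$. $\mathbb{R}_+=[0,\infty)$. $\int\cdot\,\Delta s$ and $\int\cdot\,\Delta t$ are delta integrals on $\mathbb{T}_1$ and $\mathbb{T}_2$; $\int_a^b\cdot\,\Delta q$ is the integral over $I$ (the ordinary integral, $I$ being a real interval). $C_{rd}(A,B)$ denotes the rd-continuous functions from $A$ to $B$, in the standard sense of time scale calculus with respect to the time-scale variables (continuity at right-dense points, finite one-sided limits at left-dense points), jointly with continuity in the real variables. $u^{\Delta_1},u^{\Delta_2}$ are the delta partial derivatives of $u(x,y,z)$ with respect to $x\in\mathbb{T}_1$ and $y\in\mathbb{T}_2$, and $u^{\Delta_2\Delta_1}=u^{\Delta_1\Delta_2}$ is the mixed delta derivative. A solution of the problem is a function $u\in C_{rd}(\overline\Omega,\mathbb{R})$ (with the delta derivatives that occur) satisfying the equation and the two boundary conditions; equivalently, $u(x,y,z)=\alpha(x,z)+\beta(y,z)-\alpha(x_0,z)+\int_{x_0}^x\int_{y_0}^y f(s,t,z,u(s,t,z),(hu)(s,t,z))\,\Delta t\,\Delta s$. *)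

theory Defs imports "HOL-Analysis.Analysis" begin

definition time_scale :: "real set \<Rightarrow> bool" where
  "time_scale T \<longleftrightarrow> closed T \<and> T \<noteq> {}"

text \<open>The conventions are those of Bohner and Peterson: the forward (backward) jump of a
  maximum (minimum) of \<open>T\<close> is the point itself, and such a point does not count as
  right-dense (left-dense).\<close>

definition fwd_jump :: "real set \<Rightarrow> real \<Rightarrow> real" where
  "fwd_jump T t = (if \<exists>s\<in>T. t < s then Inf {s\<in>T. t < s} else t)"

definition bwd_jump :: "real set \<Rightarrow> real \<Rightarrow> real" where
  "bwd_jump T t = (if \<exists>s\<in>T. s < t then Sup {s\<in>T. s < t} else t)"

definition right_scattered :: "real set \<Rightarrow> real \<Rightarrow> bool" where
  "right_scattered T t \<longleftrightarrow> t < fwd_jump T t"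

definition right_dense :: "real set \<Rightarrow> real \<Rightarrow> bool" where
  "right_dense T t \<longleftrightarrow> (\<exists>s\<in>T. t < s) \<and> fwd_jump T t = t"

definition left_dense :: "real set \<Rightarrow> real \<Rightarrow> bool" where
  "left_dense T t \<longleftrightarrow> (\<exists>s\<in>T. s < t) \<and> bwd_jump T t = t"

text \<open>\<open>ts_kappa T\<close> is \<open>T\<close> without its left-scattered maximum, if there is one. In the
  degenerate case of a one-point \<open>T\<close>, where a delta derivative makes no sense, it is empty.\<close>

definition ts_kappa :: "real set \<Rightarrow> real set" where
  "ts_kappa T = {t\<in>T. (\<exists>s\<in>T. t < s) \<or> left_dense T t}"

definition has_delta_derivative ::
    "real set \<Rightarrow> (real \<Rightarrow> real) \<Rightarrow> real \<Rightarrow> real \<Rightarrow> bool" where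
  "has_delta_derivative T F D t \<longleftrightarrow>
     (\<forall>\<epsilon>>0. \<exists>\<delta>>0. \<forall>s\<in>T. \<bar>s - t\<bar> < \<delta> \<longrightarrow>
        \<bar>F (fwd_jump T t) - F s - D * (fwd_jump T t - s)\<bar> \<le> \<epsilon> * \<bar>fwd_jump T t - s\<bar>)"

text \<open>The (Cauchy) delta integral: \<open>F\<close> is a pre-antiderivative of \<open>f\<close>, that is, it is continuous
  and has delta derivative \<open>f\<close> outside a countable set without right-scattered points.
  Exceptional points are needed, for instance, at a left-dense maximum of \<open>T\<close>, where an
  rd-continuous function may be discontinuous. As a relation with a real value, it also expresses
  that the integral exists and is finite.\<close>

definition has_delta_integral ::
    "real set \<Rightarrow> (real \<Rightarrow> real) \<Rightarrow> real \<Rightarrow> real \<Rightarrow> real \<Rightarrow> bool" where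
  "has_delta_integral T f r s J \<longleftrightarrow>
     (\<exists>F N. continuous_on T F \<and> countable N \<and> (\<forall>t\<in>N. \<not> right_scattered T t) \<and>
        (\<forall>t\<in>ts_kappa T - N. has_delta_derivative T F (f t) t) \<and>
        J = F s - F r)"

text \<open>The iterated integral of \<open>g\<close>, the inner one over \<open>[y\<^sub>0, y]\<close> in \<open>Y\<close>, the outer one over
  \<open>[x\<^sub>0, x]\<close> in \<open>X\<close>.\<close>

definition has_iterated_delta_integral ::
    "real set \<Rightarrow> real set \<Rightarrow> (real \<Rightarrow> real \<Rightarrow> real) \<Rightarrow>
     real \<Rightarrow> real \<Rightarrow> real \<Rightarrow> real \<Rightarrow> real \<Rightarrow> bool" where
  "has_iterated_delta_integral X Y g x0 x y0 y J \<longleftrightarrow>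
     (\<exists>G. (\<forall>s\<in>X. has_delta_integral Y (g s) y0 y (G s)) \<and> has_delta_integral X G x0 x J)"

text \<open>The ways to approach \<open>t\<close> in \<open>T\<close> that matter for rd-continuity: without restriction
  if \<open>t\<close> is right-dense; otherwise staying at \<open>t\<close>, or strictly from the left. A function is
  rd-continuous if it has a finite limit for each choice of approach in the time-scale
  variables (the real variables \<open>w \<in> W\<close> varying jointly and freely), and this limit is the value at
  the point whenever the approach does not exclude the point. If \<open>t\<close> is left-scattered, the
  approach from the left gives the trivial filter, hence no condition.\<close>

definition rd_approach :: "real set \<Rightarrow> real \<Rightarrow> real set set" where
  "rd_approach T t = (if right_dense T t then {T} else {{t}, {s\<in>T. s < t}})"

definition rd_continuous1 ::
    "real set \<Rightarrow> 'w::topological_space set \<Rightarrow> (real \<Rightarrow> 'w \<Rightarrow> real) \<Rightarrow> bool" where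
  "rd_continuous1 T W f \<longleftrightarrow>
     (\<forall>t\<in>T. \<forall>w\<in>W. \<forall>A\<in>rd_approach T t.
        \<exists>l. ((\<lambda>(t', w'). f t' w') \<longlongrightarrow> l) (at (t, w) within A \<times> W) \<and>
            (t \<in> A \<longrightarrow> l = f t w))"

definition rd_continuous2 ::
    "real set \<Rightarrow> real set \<Rightarrow> 'w::topological_space set \<Rightarrow>
     (real \<Rightarrow> real \<Rightarrow> 'w \<Rightarrow> real) \<Rightarrow> bool" where
  "rd_continuous2 X Y W f \<longleftrightarrow>
     (\<forall>x\<in>X. \<forall>y\<in>Y. \<forall>w\<in>W. \<forall>A\<in>rd_approach X x. \<forall>B\<in>rd_approach Y y.
        \<exists>l. ((\<lambda>(x', y', w'). f x' y' w') \<longlongrightarrow> l) (at (x, y, w) within A \<times> B \<times> W) \<and>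
            (x \<in> A \<and> y \<in> B \<longrightarrow> l = f x y w))"

text \<open>The mixed derivative \<open>u\<^sup>\<Delta>\<^sup>2\<^sup>\<Delta>\<^sup>1\<close> on \<open>X \<times> Y \<times> I\<close> exists and equals \<open>D\<close>: first differentiate
  in the second variable, then in the first.\<close>

definition has_mixed_delta_derivative ::
    "real set \<Rightarrow> real set \<Rightarrow> real set \<Rightarrow> (real \<Rightarrow> real \<Rightarrow> real \<Rightarrow> real) \<Rightarrow>
     (real \<Rightarrow> real \<Rightarrow> real \<Rightarrow> real) \<Rightarrow> bool" where
  "has_mixed_delta_derivative X Y I u D \<longleftrightarrow>
     (\<exists>u2.
        (\<forall>x\<in>X. \<forall>y\<in>ts_kappa Y. \<forall>z\<in>I. has_delta_derivative Y (\<lambda>t. u x t z) (u2 x y z) y) \<and>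
        (\<forall>x\<in>ts_kappa X. \<forall>y\<in>ts_kappa Y. \<forall>z\<in>I.
            has_delta_derivative X (\<lambda>s. u2 s y z) (D x y z) x))"

definition h_op ::
    "real \<Rightarrow> real \<Rightarrow> (real \<Rightarrow> real \<Rightarrow> real \<Rightarrow> real \<Rightarrow> real \<Rightarrow> real) \<Rightarrow>
     (real \<Rightarrow> real \<Rightarrow> real \<Rightarrow> real) \<Rightarrow> real \<Rightarrow> real \<Rightarrow> real \<Rightarrow> real" where
  "h_op a b j u x y z = integral {a..b} (\<lambda>q. j x y z q (u x y q))"

text \<open>The unknown \<open>u\<close> is only defined for \<open>x \<ge> x\<^sub>0\<close> and \<open>y \<ge> y\<^sub>0\<close>, so rd-continuity and
  differentiation refer to the truncated time scales \<open>T1 \<inter> {x0..}\<close> and \<open>T2 \<inter> {y0..}\<close>.\<close>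

definition is_solution ::
    "real set \<Rightarrow> real set \<Rightarrow> real \<Rightarrow> real \<Rightarrow> real \<Rightarrow> real \<Rightarrow>
     (real \<Rightarrow> real \<Rightarrow> real \<Rightarrow> real \<Rightarrow> real \<Rightarrow> real) \<Rightarrow>
     (real \<Rightarrow> real \<Rightarrow> real \<Rightarrow> real \<Rightarrow> real \<Rightarrow> real) \<Rightarrow>
     (real \<Rightarrow> real \<Rightarrow> real) \<Rightarrow> (real \<Rightarrow> real \<Rightarrow> real) \<Rightarrow>
     (real \<Rightarrow> real \<Rightarrow> real \<Rightarrow> real) \<Rightarrow> bool" where
  "is_solution T1 T2 x0 y0 a b f j \<alpha> \<beta> u \<longleftrightarrow>
     rd_continuous2 (T1 \<inter> {x0..}) (T2 \<inter> {y0..}) {a..b} u \<and>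
     has_mixed_delta_derivative (T1 \<inter> {x0..}) (T2 \<inter> {y0..}) {a..b} u
       (\<lambda>x y z. f x y z (u x y z) (h_op a b j u x y z)) \<and>
     (\<forall>x\<in>T1 \<inter> {x0..}. \<forall>z\<in>{a..b}. u x y0 z = \<alpha> x z) \<and>
     (\<forall>y\<in>T2 \<inter> {y0..}. \<forall>z\<in>{a..b}. u x0 y z = \<beta> y z)"

end

theory Submission imports Defs begin

text \<open>The difference \<open>w\<close> of two solutions vanishes for \<open>x = x\<^sub>0\<close> and for \<open>y = y\<^sub>0\<close>. On a compact
  rectangle \<open>p\<^sub>1\<close> and \<open>p\<^sub>2\<close> are bounded, since rd-continuous functions are, so the mixed
  derivative of \<open>w\<close> at \<open>(x, y, z)\<close> is at most \<open>M * sup\<^sub>q \<bar>w x y q\<bar>\<close> for a constant \<open>M\<close>. If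
  \<open>\<bar>w x y z\<bar> \<le> K * exp (L * (x + y))\<close>, then applying a mean value inequality in \<open>x\<close> and then in \<open>y\<close> gives the
  same bound with \<open>M * K / L\<^sup>2\<close> in place of \<open>K\<close>. For large \<open>L\<close> this is a contraction, and \<open>w = 0\<close>.\<close>

section \<open>Delta derivatives\<close>

lemma fwd_jump_ge: "t \<le> fwd_jump T t"
  unfolding fwd_jump_def by (auto intro!: cInf_greatest)

lemma fwd_jump_le:
  assumes "s \<in> T" "t < s"
  shows "fwd_jump T t \<le> s"
proof -
  have "bdd_below {s \<in> T. t < s}"
    by (rule bdd_belowI[of _ t]) auto
  then show ?thesis
    using assms unfolding fwd_jump_def by (auto intro!: cInf_lower)
qed

lemma fwd_jump_in:
  assumes "closed T" "t \<in> T"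
  shows "fwd_jump T t \<in> T"
proof (cases "\<exists>s\<in>T. t < s")
  case True
  have "Inf {s \<in> T. t < s} \<in> closure {s \<in> T. t < s}"
    using True by (intro closure_contains_Inf bdd_belowI[of _ t]) auto
  also have "\<dots> \<subseteq> T"
    using assms by (intro closure_minimal) auto
  finally show ?thesis
    using True by (simp add: fwd_jump_def)
qed (use assms in \<open>simp add: fwd_jump_def\<close>)

lemma fwd_jump_approx:
  assumes "\<exists>s\<in>T. t < s" "fwd_jump T t < c"
  shows "\<exists>s\<in>T. t < s \<and> s < c"
  using cInf_lessD[of "{s \<in> T. t < s}" c] assms by (auto simp: fwd_jump_def)

lemma left_dense_approx:
  assumes "left_dense T t" "c < t"
  shows "\<exists>s\<in>T. c < s \<and> s < t"
  using less_cSupD[of "{s \<in> T. s < t}" c] assms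
  by (auto simp: left_dense_def bwd_jump_def split: if_splits)

text \<open>This supplies nonzero increments \<open>fwd_jump T t - s\<close> arbitrarily near
  \<open>t\<close>, which uniqueness of the delta derivative requires. At a right-scattered point
  \<open>s = t\<close> serves; otherwise points of \<open>T\<close> accumulate at \<open>t\<close>
  from the right or from the left.\<close>

lemma ts_kappa_approx:
  assumes "t \<in> ts_kappa T" "\<delta> > 0"
  shows "\<exists>s\<in>T. \<bar>s - t\<bar> < \<delta> \<and> s \<noteq> fwd_jump T t"
proof (cases "fwd_jump T t = t")
  case True
  from assms(1) consider "\<exists>s\<in>T. t < s" | "left_dense T t"
    by (auto simp: ts_kappa_def)
  then show ?thesis
  proof cases
    case 1
    then show ?thesis
      using fwd_jump_approx[of T t "t + \<delta>"] True assms(2) by force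
  next
    case 2
    then show ?thesis
      using left_dense_approx[of T t "t - \<delta>"] True assms(2) by force
  qed
next
  case False
  then show ?thesis
    using assms by (intro bexI[of _ t]) (auto simp: ts_kappa_def)
qed

section \<open>Rules for delta derivatives: differences, uniqueness, jumps, continuity\<close>

lemma has_delta_derivativeE:
  assumes "has_delta_derivative T F D t" "\<epsilon> > 0"
  obtains \<delta> where "\<delta> > 0" "\<And>s. s \<in> T \<Longrightarrow> \<bar>s - t\<bar> < \<delta> \<Longrightarrow>
    \<bar>F (fwd_jump T t) - F s - D * (fwd_jump T t - s)\<bar> \<le> \<epsilon> * \<bar>fwd_jump T t - s\<bar>"
  using assms unfolding has_delta_derivative_def by blast

lemma has_delta_derivative_diff:
  assumes "has_delta_derivative T F D t" "has_delta_derivative T G E t"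
  shows "has_delta_derivative T (\<lambda>s. F s - G s) (D - E) t"
  unfolding has_delta_derivative_def
proof (intro allI impI)
  fix \<epsilon> :: real assume "\<epsilon> > 0"
  let ?\<sigma> = "fwd_jump T t"
  obtain d where d: "d > 0" "\<And>s. s \<in> T \<Longrightarrow> \<bar>s - t\<bar> < d \<Longrightarrow>
      \<bar>F ?\<sigma> - F s - D * (?\<sigma> - s)\<bar> \<le> \<epsilon> / 2 * \<bar>?\<sigma> - s\<bar>"
    using has_delta_derivativeE[OF assms(1) half_gt_zero[OF \<open>\<epsilon> > 0\<close>]] by blast
  obtain e where e: "e > 0" "\<And>s. s \<in> T \<Longrightarrow> \<bar>s - t\<bar> < e \<Longrightarrow>
      \<bar>G ?\<sigma> - G s - E * (?\<sigma> - s)\<bar> \<le> \<epsilon> / 2 * \<bar>?\<sigma> - s\<bar>"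
    using has_delta_derivativeE[OF assms(2) half_gt_zero[OF \<open>\<epsilon> > 0\<close>]] by blast
  show "\<exists>\<delta>>0. \<forall>s\<in>T. \<bar>s - t\<bar> < \<delta> \<longrightarrow>
      \<bar>F ?\<sigma> - G ?\<sigma> - (F s - G s) - (D - E) * (?\<sigma> - s)\<bar> \<le> \<epsilon> * \<bar>?\<sigma> - s\<bar>"
  proof (intro exI[of _ "min d e"] conjI ballI impI)
    fix s assume s: "s \<in> T" "\<bar>s - t\<bar> < min d e"
    have "F ?\<sigma> - G ?\<sigma> - (F s - G s) - (D - E) * (?\<sigma> - s)
        = (F ?\<sigma> - F s - D * (?\<sigma> - s)) - (G ?\<sigma> - G s - E * (?\<sigma> - s))"
      by (simp add: algebra_simps)
    then show "\<bar>F ?\<sigma> - G ?\<sigma> - (F s - G s) - (D - E) * (?\<sigma> - s)\<bar> \<le> \<epsilon> * \<bar>?\<sigma> - s\<bar>"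
      using d(2)[of s] e(2)[of s] s by linarith
  qed (use d e in auto)
qed

text \<open>Closedness of \<open>T\<close> keeps \<open>fwd_jump T t\<close> in \<open>T\<close>, so
  the definition only evaluates the function at points of \<open>T\<close>.\<close>

lemma has_delta_derivative_cong:
  assumes "closed T" "t \<in> T" "\<And>s. s \<in> T \<Longrightarrow> F s = G s" "has_delta_derivative T F D t"
  shows "has_delta_derivative T G D t"
  using assms fwd_jump_in[OF assms(1,2)] unfolding has_delta_derivative_def by simp

text \<open>The zero function has the delta derivative \<open>E - D\<close>. Dividing its error
  estimate by a nonzero increment bounds \<open>\<bar>E - D\<bar>\<close> by every positive
  \<open>e\<close>.\<close>

lemma has_delta_derivative_unique:
  assumes "has_delta_derivative T F D t" "has_delta_derivative T F E t" "t \<in> ts_kappa T"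
  shows "D = E"
proof -
  have "\<bar>E - D\<bar> \<le> 0 + e" if e: "e > 0" for e
  proof -
    let ?\<sigma> = "fwd_jump T t"
    have "has_delta_derivative T (\<lambda>s. 0) (E - D) t"
      using has_delta_derivative_diff[OF assms(2,1)] by simp
    then obtain d where d: "d > 0" "\<And>s. s \<in> T \<Longrightarrow> \<bar>s - t\<bar> < d \<Longrightarrow>
        \<bar>0 - 0 - (E - D) * (?\<sigma> - s)\<bar> \<le> e * \<bar>?\<sigma> - s\<bar>"
      using has_delta_derivativeE[OF _ e] by blast
    obtain s where "s \<in> T" "\<bar>s - t\<bar> < d" "s \<noteq> ?\<sigma>"
      using ts_kappa_approx[OF assms(3) d(1)] by blast
    then show ?thesis
      using d(2)[of s] by (simp add: abs_mult flip: left_diff_distrib)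
  qed
  then have "\<bar>E - D\<bar> \<le> 0"
    by (rule field_le_epsilon)
  then show ?thesis
    by simp
qed

text \<open>The choice \<open>s = t\<close> in the definition leaves an error of at most \<epsilon>
  times a fixed length, for every \<epsilon>, hence none.\<close>

lemma has_delta_derivative_jump:
  assumes "has_delta_derivative T F D t" "t \<in> T"
  shows "F (fwd_jump T t) - F t = D * (fwd_jump T t - t)"
proof -
  let ?\<sigma> = "fwd_jump T t"
  have "\<bar>F ?\<sigma> - F t - D * (?\<sigma> - t)\<bar> \<le> 0 + e" if "e > 0" for e
  proof -
    define k where "k = e / (\<bar>?\<sigma> - t\<bar> + 1)"
    have "k > 0"
      using that by (simp add: k_def add_nonneg_pos)
    then have "\<bar>F ?\<sigma> - F t - D * (?\<sigma> - t)\<bar> \<le> k * \<bar>?\<sigma> - t\<bar>"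
      using assms unfolding has_delta_derivative_def by force
    also have "\<dots> \<le> k * (\<bar>?\<sigma> - t\<bar> + 1)"
      using \<open>k > 0\<close> by simp
    also have "\<dots> = e"
      by (simp add: k_def add_nonneg_eq_0_iff)
    finally show ?thesis
      by simp
  qed
  then have "\<bar>F ?\<sigma> - F t - D * (?\<sigma> - t)\<bar> \<le> 0"
    by (rule field_le_epsilon)
  then show ?thesis
    by simp
qed

text \<open>The definition compares \<open>F s\<close> with the value at the jump of
  \<open>t\<close>; the exact jump formula converts this into a comparison with \<open>F t\<close>,
  leaving a linear term and a remainder.\<close>

lemma has_delta_derivative_imp_continuous:
  assumes "has_delta_derivative T F D t" "t \<in> T"
  shows "continuous (at t within T) F"
  unfolding continuous_within_eps_delta
proof (intro allI impI)
  fix e :: real assume "e > 0"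
  let ?\<sigma> = "fwd_jump T t"
  \<comment> \<open>For \<open>s\<close> within distance 1 of \<open>t\<close>, the increment to the
    jump is at most \<open>\<bar>?\<sigma> - t\<bar> + 1\<close>, so this tolerance keeps the
    remainder at most \<open>e / 2\<close>.\<close>
  define k where "k = e / 2 / (\<bar>?\<sigma> - t\<bar> + 1)"
  have pos: "\<bar>?\<sigma> - t\<bar> + 1 > 0" "\<bar>D\<bar> + 1 > 0"
    by auto
  then have "k > 0"
    using \<open>e > 0\<close> by (simp add: k_def)
  then obtain d where d: "d > 0" "\<And>s. s \<in> T \<Longrightarrow> \<bar>s - t\<bar> < d \<Longrightarrow>
      \<bar>F ?\<sigma> - F s - D * (?\<sigma> - s)\<bar> \<le> k * \<bar>?\<sigma> - s\<bar>"
    using has_delta_derivativeE[OF assms(1)] by blast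
  \<comment> \<open>The three bounds serve the derivative estimate, the \<open>+ 1\<close> in
    \<open>k\<close>, and the linear term \<open>D * (s - t)\<close>.\<close>
  define d' where "d' = min (min d 1) (e / 2 / (\<bar>D\<bar> + 1))"
  have "d' > 0"
    using d \<open>e > 0\<close> pos by (simp add: d'_def)
  show "\<exists>d>0. \<forall>s\<in>T. dist s t < d \<longrightarrow> dist (F s) (F t) < e"
  proof (intro exI[of _ d'] conjI ballI impI)
    fix s assume s: "s \<in> T" "dist s t < d'"
    have "\<bar>F ?\<sigma> - F s - D * (?\<sigma> - s)\<bar> \<le> k * \<bar>?\<sigma> - s\<bar>"
      using s by (intro d) (auto simp: d'_def dist_real_def)
    also have "\<dots> \<le> k * (\<bar>?\<sigma> - t\<bar> + 1)"
      using s \<open>k > 0\<close> by (intro mult_left_mono) (auto simp: d'_def dist_real_def)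
    also have "\<dots> = e / 2"
      using pos(1) by (simp add: k_def field_simps)
    finally have 1: "\<bar>F ?\<sigma> - F s - D * (?\<sigma> - s)\<bar> \<le> e / 2" .
    have "\<bar>D * (s - t)\<bar> \<le> (\<bar>D\<bar> + 1) * \<bar>s - t\<bar>"
      by (simp add: abs_mult mult_right_mono)
    also have "\<dots> < (\<bar>D\<bar> + 1) * (e / 2 / (\<bar>D\<bar> + 1))"
      using s by (intro mult_strict_left_mono) (auto simp: d'_def dist_real_def)
    also have "\<dots> = e / 2"
      using pos(2) by (simp add: field_simps)
    finally have 2: "\<bar>D * (s - t)\<bar> < e / 2" .
    have "F s - F t = D * (s - t) - (F ?\<sigma> - F s - D * (?\<sigma> - s))"
      using has_delta_derivative_jump[OF assms] by (simp add: algebra_simps)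
    then show "dist (F s) (F t) < e"
      using 1 2 unfolding dist_real_def by linarith
  qed fact
qed

text \<open>Monotonicity of \<open>p\<close> makes the real primitive \<open>P\<close> grow at least as fast as a delta
  antiderivative of \<open>p\<close>, across the gaps of \<open>T\<close> too.\<close>

lemma delta_mean_value_bound:
  fixes P p :: "real \<Rightarrow> real"
  assumes T: "closed T" "t0 \<in> T" "t1 \<in> T" "t0 \<le> t1"
    and F: "\<And>t. t \<in> ts_kappa T \<Longrightarrow> t0 \<le> t \<Longrightarrow> t \<le> t1 \<Longrightarrow> has_delta_derivative T F (D t) t"
    and D: "\<And>t. t \<in> ts_kappa T \<Longrightarrow> t0 \<le> t \<Longrightarrow> t \<le> t1 \<Longrightarrow> \<bar>D t\<bar> \<le> p t"
    and P: "\<And>t. (P has_real_derivative p t) (at t)"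
    and "mono p"
  shows "\<bar>F t1 - F t0\<bar> \<le> P t1 - P t0"
proof -
  \<comment> \<open>Since \<open>p\<close> is monotone, its value at the left endpoint bounds the
    growth of \<open>P\<close> from below, over an interval of any length. Hence a jump of
    \<open>F\<close> with slope \<open>D s\<close> is dominated as well.\<close>
  have P_lower: "p s * (t - s) \<le> P t - P s" if "s \<le> t" for s t
  proof (cases "s = t")
    case False
    then obtain z where "s < z" "P t - P s = (t - s) * p z"
      using MVT2[of s t P p] P \<open>s \<le> t\<close> by auto
    then show ?thesis
      using monoD[OF \<open>mono p\<close>, of s z] \<open>s \<le> t\<close>
      by (simp add: mult.commute mult_right_mono)
  qed simp
  \<comment> \<open>The slack proportional to \<epsilon> absorbs the remainders of the delta
    derivative. If the bound fails at \<open>t1\<close>, the infimum \<open>c\<close> of the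
    failures gives a contradiction.\<close>
  have main: "\<bar>F t1 - F t0\<bar> \<le> (P t1 - P t0) + \<epsilon> * (t1 - t0)" if "\<epsilon> > 0" for \<epsilon>
  proof (rule ccontr)
    define good where
      "good s \<longleftrightarrow> \<bar>F s - F t0\<bar> \<le> (P s - P t0) + \<epsilon> * (s - t0)" for s
    assume "\<not> \<bar>F t1 - F t0\<bar> \<le> (P t1 - P t0) + \<epsilon> * (t1 - t0)"
    then have bad: "\<not> good t1"
      by (simp add: good_def)
    have step: "good t" if "good s" "s \<in> ts_kappa T" "t0 \<le> s" "s \<le> t1" "s \<le> t"
      "\<bar>F t - F s - D s * (t - s)\<bar> \<le> \<epsilon> * (t - s)" for s t
    proof -
      have "\<bar>D s * (t - s)\<bar> \<le> p s * (t - s)"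
        using D[of s] that by (simp add: abs_mult mult_right_mono)
      then have "\<bar>F t - F s\<bar> \<le> (P t - P s) + \<epsilon> * (t - s)"
        using P_lower[of s t] that by linarith
      then show ?thesis
        using \<open>good s\<close> unfolding good_def by (simp add: algebra_simps)
    qed
    \<comment> \<open>Across a gap the increment of \<open>F\<close> is exactly linear, so the
      remainder required by \<open>step\<close> vanishes.\<close>
    have step_jump: "good (fwd_jump T s)"
      if "good s" "s \<in> ts_kappa T" "t0 \<le> s" "s \<le> t1" for s
    proof (rule step[OF that fwd_jump_ge])
      have "F (fwd_jump T s) - F s = D s * (fwd_jump T s - s)"
        using that by (intro has_delta_derivative_jump F) (auto simp: ts_kappa_def)
      then show "\<bar>F (fwd_jump T s) - F s - D s * (fwd_jump T s - s)\<bar> \<le> \<epsilon> * (fwd_jump T s - s)"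
        using \<open>\<epsilon> > 0\<close> fwd_jump_ge[of s T] by simp
    qed
    define B where "B = {s \<in> T. t0 \<le> s \<and> s \<le> t1 \<and> \<not> good s}"
    define c where "c = Inf B"
    have "B \<noteq> {}" "bdd_below B"
      using bad T by (auto simp: B_def intro: bdd_belowI[of _ t0])
    then have "c \<in> closure B"
      unfolding c_def by (intro closure_contains_Inf)
    also have "closure B \<subseteq> T \<inter> {t0..t1}"
      using T by (intro closure_minimal closed_Int) (auto simp: B_def)
    finally have c: "c \<in> T" "t0 \<le> c" "c \<le> t1"
      by auto
    have below: "good s" if "s \<in> T" "t0 \<le> s" "s < c" for s
      using that cInf_lower[OF _ \<open>bdd_below B\<close>, of s] c by (fastforce simp: B_def c_def)
    have not_above: "\<not> (\<forall>s\<in>B. e \<le> s)" if "c < e" for e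
      using cInf_greatest[OF \<open>B \<noteq> {}\<close>, of e] that by (auto simp: c_def)
    show False
    proof (cases "good c")
      case True
      then have "c < t1"
        using bad c by (cases "c = t1") auto
      then have ck: "c \<in> ts_kappa T"
        using T c by (auto simp: ts_kappa_def)
      have B_gt: "c < s" if "s \<in> B" for s
        using that True cInf_lower[OF that \<open>bdd_below B\<close>]
        by (cases "s = c") (auto simp: B_def c_def)
      \<comment> \<open>All failures lie strictly to the right of \<open>c\<close>, yet come
        arbitrarily close to it. At a right-dense \<open>c\<close> the delta derivative makes the
        points shortly after \<open>c\<close> good; at a right-scattered \<open>c\<close> there is
        no point of \<open>T\<close> before the jump.\<close>
      show False
      proof (cases "fwd_jump T c = c")
        case True
        obtain d where d: "d > 0" "\<And>s. s \<in> T \<Longrightarrow> \<bar>s - c\<bar> < d \<Longrightarrow>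
            \<bar>F c - F s - D c * (c - s)\<bar> \<le> \<epsilon> * \<bar>c - s\<bar>"
          using has_delta_derivativeE[OF F[OF ck c(2,3)] \<open>\<epsilon> > 0\<close>] unfolding True by blast
        have "\<forall>s\<in>B. c + d \<le> s"
        proof (rule ballI, rule ccontr)
          fix s assume s: "s \<in> B" "\<not> c + d \<le> s"
          then have "c < s" "s \<in> T"
            using B_gt by (auto simp: B_def)
          then have "\<bar>F c - F s - D c * (c - s)\<bar> \<le> \<epsilon> * (s - c)"
            using d(2)[of s] s by auto
          then have "good s"
            using \<open>c < s\<close> by (intro step[OF \<open>good c\<close> ck c(2,3)]) (auto simp: algebra_simps)
          then show False
            using s by (simp add: B_def)
        qed
        then show False
          using not_above[of "c + d"] d by simp
      next
        case False
        then show False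
          using not_above[of "fwd_jump T c"] fwd_jump_ge[of c T] fwd_jump_le[of _ T c] B_gt
          by (auto simp: B_def)
      qed
    next
      case False
      \<comment> \<open>Here \<open>c\<close> itself fails, while earlier points from
        \<open>t0\<close> on are good. At a left-dense \<open>c\<close> continuity would spread the
        failure to points before \<open>c\<close>; otherwise \<open>c\<close> is the jump of a good
        predecessor and must be good.\<close>
      have "c \<noteq> t0"
        using False by (auto simp: good_def)
      then have "\<exists>s\<in>T. s < c"
        using c T by (intro bexI[of _ t0]) auto
      show False
      proof (cases "left_dense T c")
        case True
        then have "has_delta_derivative T F (D c) c"
          using c by (intro F) (auto simp: ts_kappa_def)
        then have "continuous (at c within T) F"
          using c by (intro has_delta_derivative_imp_continuous)
        moreover have "continuous (at c within T) P"
          using P by (meson DERIV_isCont continuous_at_imp_continuous_within)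
        ultimately have "continuous (at c within T)
            (\<lambda>s. \<bar>F s - F t0\<bar> - ((P s - P t0) + \<epsilon> * (s - t0)))"
          by (intro continuous_intros)
        moreover have "0 < \<bar>F c - F t0\<bar> - ((P c - P t0) + \<epsilon> * (c - t0))"
          using False by (simp add: good_def)
        ultimately have "\<forall>\<^sub>F s in at c within T. 0 < \<bar>F s - F t0\<bar> - ((P s - P t0) + \<epsilon> * (s - t0))"
          unfolding continuous_within by (rule order_tendstoD(1))
        then obtain d where d: "d > 0"
          "\<And>s. s \<in> T \<Longrightarrow> s \<noteq> c \<Longrightarrow> dist s c < d \<Longrightarrow> \<not> good s"
          unfolding eventually_at good_def by force
        obtain s where "s \<in> T" "max t0 (c - d) < s" "s < c"
          using left_dense_approx[OF True, of "max t0 (c - d)"] d c \<open>c \<noteq> t0\<close> by auto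
        then show False
          using d(2)[of s] below[of s] by (auto simp: dist_real_def)
      next
        case left: False
        \<comment> \<open>\<open>r\<close> is the predecessor of \<open>c\<close> in
          \<open>T\<close>: the supremum is attained in \<open>T\<close> by closedness and differs
          from \<open>c\<close> because \<open>c\<close> is not left-dense.\<close>
        define r where "r = Sup {s \<in> T. s < c}"
        have bdd: "bdd_above {s \<in> T. s < c}"
          by (rule bdd_aboveI[of _ c]) auto
        have "r \<in> closure {s \<in> T. s < c}"
          using \<open>\<exists>s\<in>T. s < c\<close> bdd unfolding r_def by (intro closure_contains_Sup) auto
        also have "\<dots> \<subseteq> T \<inter> {..c}"
          using T by (intro closure_minimal) auto
        finally have r: "r \<in> T" "r \<le> c"
          by auto
        have "r \<noteq> c"
          using left \<open>\<exists>s\<in>T. s < c\<close> by (auto simp: left_dense_def bwd_jump_def r_def)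
        have r_max: "s \<le> r" if "s \<in> T" "s < c" for s
          unfolding r_def using that by (intro cSup_upper bdd) auto
        have "r < c" "t0 \<le> r"
          using r \<open>r \<noteq> c\<close> r_max[of t0] T c \<open>c \<noteq> t0\<close> by auto
        have "fwd_jump T r = c"
        proof -
          have "\<not> fwd_jump T r < c"
            using fwd_jump_approx[of T r c] r_max c \<open>r < c\<close> by force
          then show ?thesis
            using fwd_jump_le[of c T r] c \<open>r < c\<close> by simp
        qed
        moreover have "good (fwd_jump T r)"
          using r c \<open>r < c\<close> \<open>t0 \<le> r\<close> by (intro step_jump below) (auto simp: ts_kappa_def)
        ultimately show False
          using False by simp
      qed
    qed
  qed
  show ?thesis
  proof (rule field_le_epsilon)
    fix e :: real assume "e > 0"
    \<comment> \<open>The slack is made at most \<open>e\<close>; the \<open>+ 1\<close> keeps the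
      denominator positive when \<open>t0 = t1\<close>.\<close>
    have "\<bar>F t1 - F t0\<bar> \<le> (P t1 - P t0) + e / (t1 - t0 + 1) * (t1 - t0)"
      using \<open>e > 0\<close> T by (intro main) simp
    also have "e / (t1 - t0 + 1) * (t1 - t0) \<le> e / (t1 - t0 + 1) * (t1 - t0 + 1)"
      using \<open>e > 0\<close> T by (intro mult_left_mono) auto
    also have "\<dots> = e"
      using T by simp
    finally show "\<bar>F t1 - F t0\<bar> \<le> (P t1 - P t0) + e"
      by simp
  qed
qed

section \<open>Rd-continuous functions\<close>

text \<open>If \<open>t\<close> is not right-dense, points of \<open>T\<close> beyond
  \<open>t\<close>, if any, start at \<open>fwd_jump T t > t\<close>, so near \<open>t\<close> only
  \<open>t\<close> itself and points to its left remain.\<close>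

lemma rd_approach_cover: "\<forall>\<^sub>F s in nhds t. s \<in> T \<longrightarrow> (\<exists>A\<in>rd_approach T t. s \<in> A)"
proof (cases "right_dense T t")
  case True
  then show ?thesis
    by (simp add: rd_approach_def)
next
  case False
  have "\<forall>\<^sub>F s in nhds t. s \<in> T \<longrightarrow> s \<le> t"
  proof (cases "\<exists>s\<in>T. t < s")
    case True
    then have "t < fwd_jump T t"
      using False fwd_jump_ge[of t T] by (auto simp: right_dense_def)
    then have "\<forall>\<^sub>F s in nhds t. s < fwd_jump T t"
      by (rule eventually_nhds_in_open[OF open_lessThan, simplified])
    then show ?thesis
      by eventually_elim (use fwd_jump_le[of _ T t] in force)
  qed (auto intro!: always_eventually simp: not_less)
  then show ?thesis
    by eventually_elim (use False in \<open>auto simp: rd_approach_def\<close>)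
qed

text \<open>A finite limit gives a bound along each pair of approaches. There are at most four pairs
  and together they cover a neighbourhood, so the maximum of their bounds works.\<close>

lemma rd_continuous2_locally_bounded:
  fixes f :: "real \<Rightarrow> real \<Rightarrow> 'w::topological_space \<Rightarrow> real"
  assumes f: "rd_continuous2 X Y W f" and p: "x \<in> X" "y \<in> Y" "w \<in> W"
  shows "\<exists>M. \<forall>\<^sub>F (x', y', w') in nhds (x, y, w). x' \<in> X \<longrightarrow> y' \<in> Y \<longrightarrow> w' \<in> W \<longrightarrow> \<bar>f x' y' w'\<bar> \<le> M"
proof -
  let ?g = "\<lambda>(x', y', w'). f x' y' w'" and ?p = "(x, y, w)"
  let ?R = "rd_approach X x \<times> rd_approach Y y"
  have "\<exists>M. \<forall>\<^sub>F q in nhds ?p. q \<in> fst R \<times> snd R \<times> W \<longrightarrow> \<bar>?g q\<bar> \<le> M" if "R \<in> ?R" for R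
  proof -
    from f p that obtain l where "(?g \<longlongrightarrow> l) (at ?p within fst R \<times> snd R \<times> W)"
      unfolding rd_continuous2_def by (metis mem_Times_iff)
    then have "((\<lambda>q. \<bar>?g q\<bar>) \<longlongrightarrow> \<bar>l\<bar>) (at ?p within fst R \<times> snd R \<times> W)"
      by (rule tendsto_rabs)
    then have "\<forall>\<^sub>F q in at ?p within fst R \<times> snd R \<times> W. \<bar>?g q\<bar> < \<bar>l\<bar> + 1"
      by (rule order_tendstoD) simp
    then have "\<forall>\<^sub>F q in nhds ?p. q \<noteq> ?p \<longrightarrow> q \<in> fst R \<times> snd R \<times> W \<longrightarrow> \<bar>?g q\<bar> < \<bar>l\<bar> + 1"
      by (simp only: eventually_at_filter)
    \<comment> \<open>The limit says nothing about the centre \<open>?p\<close>, whose value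
      therefore enters the maximum.\<close>
    then have "\<forall>\<^sub>F q in nhds ?p. q \<in> fst R \<times> snd R \<times> W \<longrightarrow> \<bar>?g q\<bar> \<le> max (\<bar>l\<bar> + 1) \<bar>?g ?p\<bar>"
      by eventually_elim fastforce
    then show ?thesis ..
  qed
  then have "\<exists>M. \<forall>R\<in>?R. \<forall>\<^sub>F q in nhds ?p. q \<in> fst R \<times> snd R \<times> W \<longrightarrow> \<bar>?g q\<bar> \<le> M R"
    by (intro bchoice ballI)
  then obtain M where
    M: "\<forall>R\<in>?R. \<forall>\<^sub>F q in nhds ?p. q \<in> fst R \<times> snd R \<times> W \<longrightarrow> \<bar>?g q\<bar> \<le> M R" ..
  have fin: "finite ?R"
    by (simp add: rd_approach_def)
  have "\<forall>\<^sub>F q in nhds ?p. \<forall>R\<in>?R. q \<in> fst R \<times> snd R \<times> W \<longrightarrow> \<bar>?g q\<bar> \<le> M R"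
    using fin M by (rule eventually_ball_finite)
  moreover have "\<forall>\<^sub>F q in nhds ?p. fst q \<in> X \<longrightarrow> (\<exists>A\<in>rd_approach X x. fst q \<in> A)"
    using rd_approach_cover by (rule eventually_compose_filterlim)
      (use tendsto_fst[OF filterlim_ident, of ?p] in simp)
  moreover have "\<forall>\<^sub>F q in nhds ?p. fst (snd q) \<in> Y \<longrightarrow> (\<exists>B\<in>rd_approach Y y. fst (snd q) \<in> B)"
    using rd_approach_cover by (rule eventually_compose_filterlim)
      (use tendsto_fst[OF tendsto_snd[OF filterlim_ident], of ?p] in simp)
  ultimately have "\<forall>\<^sub>F (x', y', w') in nhds ?p. x' \<in> X \<longrightarrow> y' \<in> Y \<longrightarrow> w' \<in> W \<longrightarrow>
      \<bar>f x' y' w'\<bar> \<le> Max (M ` ?R)"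
  proof eventually_elim
    case (elim q)
    obtain x' y' w' where q: "q = (x', y', w')"
      by (cases q)
    have "\<bar>f x' y' w'\<bar> \<le> Max (M ` ?R)" if in': "x' \<in> X" "y' \<in> Y" "w' \<in> W"
    proof -
      obtain A B where AB: "A \<in> rd_approach X x" "x' \<in> A" "B \<in> rd_approach Y y" "y' \<in> B"
        using elim in' by (auto simp: q)
      then have "\<bar>f x' y' w'\<bar> \<le> M (A, B)"
        using elim(1)[rule_format, of "(A, B)"] in' by (auto simp: q)
      also have "\<dots> \<le> Max (M ` ?R)"
        using fin AB by (intro Max_ge) auto
      finally show ?thesis .
    qed
    then show ?case
      by (simp add: q)
  qed
  then show ?thesis ..
qed

text \<open>A finite subcover turns the local bounds into one. It is applied to \<open>p1\<close>,
  \<open>p2\<close> and both solutions, whose real parameters range over compact sets.\<close>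

lemma rd_continuous2_bounded:
  fixes f :: "real \<Rightarrow> real \<Rightarrow> 'w::topological_space \<Rightarrow> real"
  assumes f: "rd_continuous2 X Y W f"
    and "compact C" "C \<subseteq> X" "compact D" "D \<subseteq> Y" "compact W"
  obtains M where "\<And>x y w. x \<in> C \<Longrightarrow> y \<in> D \<Longrightarrow> w \<in> W \<Longrightarrow> \<bar>f x y w\<bar> \<le> M"
proof -
  let ?S = "C \<times> D \<times> W" and ?g = "\<lambda>(x', y', w'). f x' y' w'"
  have "\<exists>U M. open U \<and> p \<in> U \<and> (\<forall>q\<in>U \<inter> ?S. \<bar>?g q\<bar> \<le> M)" if "p \<in> ?S" for p
  proof -
    obtain x y w where p: "p = (x, y, w)"
      by (cases p)
    have "\<exists>M. \<forall>\<^sub>F (x', y', w') in nhds (x, y, w).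
        x' \<in> X \<longrightarrow> y' \<in> Y \<longrightarrow> w' \<in> W \<longrightarrow> \<bar>f x' y' w'\<bar> \<le> M"
      using that assms by (intro rd_continuous2_locally_bounded[OF f]) (auto simp: p)
    then show ?thesis
      using assms unfolding eventually_nhds p by fast
  qed
  then obtain U M where U: "\<And>p. p \<in> ?S \<Longrightarrow> open (U p)" "\<And>p. p \<in> ?S \<Longrightarrow> p \<in> U p"
    and M: "\<And>p q. p \<in> ?S \<Longrightarrow> q \<in> U p \<inter> ?S \<Longrightarrow> \<bar>?g q\<bar> \<le> M p"
    by metis
  have comp: "compact ?S"
    using assms by (intro compact_Times)
  have cover: "?S \<subseteq> (\<Union>p\<in>?S. U p)"
    using U(2) by (intro subsetI UN_I)
  obtain K where K: "K \<subseteq> ?S" "finite K" "?S \<subseteq> (\<Union>p\<in>K. U p)"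
    using compactE_image[where f = U, OF comp U(1) cover] by metis
  show ?thesis
  proof
    fix x y w assume "x \<in> C" "y \<in> D" "w \<in> W"
    then have q: "(x, y, w) \<in> ?S"
      by simp
    then obtain p where "p \<in> K" "(x, y, w) \<in> U p"
      using K by blast
    then have "\<bar>f x y w\<bar> \<le> M p"
      using M[of p "(x, y, w)"] K q by auto
    also have "\<dots> \<le> Max (M ` K)"
      using \<open>p \<in> K\<close> K by (intro Max_ge) auto
    finally show "\<bar>f x y w\<bar> \<le> Max (M ` K)" .
  qed
qed

text \<open>Some approach contains the point itself, and along it the limit is the value. Freezing
  both time-scale variables there leaves ordinary continuity in the real ones.\<close>

lemma rd_continuous2_imp_continuous_on:
  fixes f :: "real \<Rightarrow> real \<Rightarrow> 'w::topological_space \<Rightarrow> real"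
  assumes f: "rd_continuous2 X Y W f" and "x \<in> X" "y \<in> Y"
  shows "continuous_on W (f x y)"
  unfolding continuous_on_def
proof
  fix w assume "w \<in> W"
  have "\<exists>A\<in>rd_approach T t. t \<in> A" if "t \<in> T" for T t
    using that by (auto simp: rd_approach_def)
  then obtain A B where A: "A \<in> rd_approach X x" "x \<in> A" and B: "B \<in> rd_approach Y y" "y \<in> B"
    using assms by meson
  let ?g = "\<lambda>(x', y', w'). f x' y' w'" and ?S = "A \<times> B \<times> W"
  have "(?g \<longlongrightarrow> f x y w) (at (x, y, w) within ?S)"
    using f assms \<open>w \<in> W\<close> A B unfolding rd_continuous2_def by metis
  moreover have "filterlim (\<lambda>w. (x, y, w)) (at (x, y, w) within ?S) (at w within W)"
    unfolding filterlim_at using A B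
    by (auto intro!: tendsto_intros simp: eventually_at_filter)
  ultimately show "(f x y \<longlongrightarrow> f x y w) (at w within W)"
    using filterlim_compose by fastforce
qed

section \<open>Contraction and uniqueness\<close>

text \<open>Subtracting the integrals requires integrability, since \<open>integral\<close>
  otherwise returns a default value. It follows by composing \<open>j\<close>, jointly continuous in
  its real arguments, with the continuous slice of a solution.\<close>

lemma h_op_lipschitz:
  assumes j: "rd_continuous2 X Y ({a..b} \<times> {a..b} \<times> UNIV) (\<lambda>x y (z, q, u). j x y z q u)"
    and uv: "rd_continuous2 X Y {a..b} u" "rd_continuous2 X Y {a..b} v"
    and x: "x \<in> X" and y: "y \<in> Y" and z: "z \<in> {a..b}"
    and le: "\<And>q. q \<in> {a..b} \<Longrightarrow> \<bar>j x y z q (u x y q) - j x y z q (v x y q)\<bar> \<le> C"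
  shows "\<bar>h_op a b j u x y z - h_op a b j v x y z\<bar> \<le> C * (b - a)"
proof -
  have cont: "continuous_on {a..b} (\<lambda>q. j x y z q (u x y q))"
    if "rd_continuous2 X Y {a..b} u" for u
  proof -
    have "continuous_on {a..b} ((\<lambda>(z, q, u). j x y z q u) \<circ> (\<lambda>q. (z, q, u x y q)))"
      using z by (intro continuous_on_compose continuous_intros
          rd_continuous2_imp_continuous_on[OF that x y]
          continuous_on_subset[OF rd_continuous2_imp_continuous_on[OF j x y]]) auto
    then show ?thesis
      by (simp add: o_def)
  qed
  have int: "(\<lambda>q. j x y z q (u x y q)) integrable_on {a..b}"
    "(\<lambda>q. j x y z q (v x y q)) integrable_on {a..b}"
    using cont uv by (auto intro: integrable_continuous_interval)
  have "h_op a b j u x y z - h_op a b j v x y z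
      = integral {a..b} (\<lambda>q. j x y z q (u x y q) - j x y z q (v x y q))"
    unfolding h_op_def by (rule integral_diff[OF int, symmetric])
  moreover have "norm \<dots> \<le> C * (b - a)"
    using z le cont uv by (intro integral_bound continuous_intros) auto
  ultimately show ?thesis
    by simp
qed

theorem theorem3p2:
  fixes T1 T2 :: "real set" and x0 y0 a b :: real
    and f j :: "real \<Rightarrow> real \<Rightarrow> real \<Rightarrow> real \<Rightarrow> real \<Rightarrow> real"
    and \<alpha> \<beta> :: "real \<Rightarrow> real \<Rightarrow> real"
    and p1 :: "real \<Rightarrow> real \<Rightarrow> real \<Rightarrow> real"
    and p2 :: "real \<Rightarrow> real \<Rightarrow> real \<Rightarrow> real \<Rightarrow> real"
  assumes "time_scale T1" and "\<exists>s\<in>T1. \<exists>t\<in>T1. s \<noteq> t" and "x0 \<in> T1"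
    and "time_scale T2" and "\<exists>s\<in>T2. \<exists>t\<in>T2. s \<noteq> t" and "y0 \<in> T2"
    and "a < b"
    and "rd_continuous2 (T1 \<inter> {x0..}) (T2 \<inter> {y0..}) ({a..b} \<times> UNIV \<times> UNIV)
           (\<lambda>x y (z, u, v). f x y z u v)"
    and "rd_continuous2 (T1 \<inter> {x0..}) (T2 \<inter> {y0..}) ({a..b} \<times> {a..b} \<times> UNIV)
           (\<lambda>x y (z, q, u). j x y z q u)"
    and "rd_continuous1 (T1 \<inter> {x0..}) {a..b} \<alpha>"
    and "rd_continuous1 (T2 \<inter> {y0..}) {a..b} \<beta>"
    and "\<forall>z\<in>{a..b}. \<alpha> x0 z = \<beta> y0 z"
    and "rd_continuous2 (T1 \<inter> {x0..}) (T2 \<inter> {y0..}) {a..b} p1"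
    and "\<forall>x\<in>T1 \<inter> {x0..}. \<forall>y\<in>T2 \<inter> {y0..}. \<forall>z\<in>{a..b}. 0 \<le> p1 x y z"
    and "rd_continuous2 (T1 \<inter> {x0..}) (T2 \<inter> {y0..}) ({a..b} \<times> {a..b})
           (\<lambda>x y (z, q). p2 x y z q)"
    and "\<forall>x\<in>T1 \<inter> {x0..}. \<forall>y\<in>T2 \<inter> {y0..}. \<forall>z\<in>{a..b}. \<forall>q\<in>{a..b}. 0 \<le> p2 x y z q"
    and "\<forall>x\<in>T1 \<inter> {x0..}. \<forall>y\<in>T2 \<inter> {y0..}. \<forall>z\<in>{a..b}. \<forall>u v u' v'.
           \<bar>f x y z u v - f x y z u' v'\<bar> \<le> p1 x y z * (\<bar>u - u'\<bar> + \<bar>v - v'\<bar>)"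
    and "\<forall>x\<in>T1 \<inter> {x0..}. \<forall>y\<in>T2 \<inter> {y0..}. \<forall>z\<in>{a..b}. \<forall>q\<in>{a..b}. \<forall>u u'.
           \<bar>j x y z q u - j x y z q u'\<bar> \<le> p2 x y z q * \<bar>u - u'\<bar>"
    and "\<forall>x\<in>T1 \<inter> {x0..}. \<forall>y\<in>T2 \<inter> {y0..}. \<forall>z\<in>{a..b}. \<exists>J.
           has_iterated_delta_integral (T1 \<inter> {x0..}) (T2 \<inter> {y0..})
             (\<lambda>s t. p1 s t z + integral {a..b} (\<lambda>q. p2 s t z q)) x0 x y0 y J"
  shows "\<forall>u v. is_solution T1 T2 x0 y0 a b f j \<alpha> \<beta> u \<longrightarrow> is_solution T1 T2 x0 y0 a b f j \<alpha> \<beta> v \<longrightarrow>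
           (\<forall>x\<in>T1 \<inter> {x0..}. \<forall>y\<in>T2 \<inter> {y0..}. \<forall>z\<in>{a..b}. u x y z = v x y z)"
proof (intro allI impI ballI)

  \<comment> \<open>Compact rectangle below a given point\<close>
  let ?X = "T1 \<inter> {x0..}" and ?Y = "T2 \<inter> {y0..}"
  fix u v x1 y1 z1
  assume u: "is_solution T1 T2 x0 y0 a b f j \<alpha> \<beta> u" and v: "is_solution T1 T2 x0 y0 a b f j \<alpha> \<beta> v"
    and x1: "x1 \<in> ?X" and y1: "y1 \<in> ?Y" and z1: "z1 \<in> {a..b}"
  note f_lip = assms(17)[rule_format] and j_lip = assms(18)[rule_format]
  have closed: "closed ?X" "closed ?Y"
    using assms(1,4) by (auto simp: time_scale_def)
  \<comment> \<open>Bounds are available on compact sets only, so the argument stays on the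
    rectangle below the given point. With a point it contains all smaller ones of \<open>?X\<close>
    and \<open>?Y\<close>, as the mean value bounds require.\<close>
  define C D where "C = ?X \<inter> {..x1}" and "D = ?Y \<inter> {..y1}"
  have "C = T1 \<inter> {x0..x1}" "D = T2 \<inter> {y0..y1}"
    by (auto simp: C_def D_def)
  then have comp: "compact C" "compact D"
    using assms(1,4) by (auto simp: time_scale_def intro: closed_Int_compact)
  have sub: "C \<subseteq> ?X" "D \<subseteq> ?Y"
    by (auto simp: C_def D_def)
  note bounded = rd_continuous2_bounded[OF _ comp(1) sub(1) comp(2) sub(2)]
  have rd: "rd_continuous2 ?X ?Y {a..b} u" "rd_continuous2 ?X ?Y {a..b} v"
    using u v by (auto simp: is_solution_def)

  \<comment> \<open>The difference of two solutions and its derivatives\<close>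
  define g where "g x y z = f x y z (u x y z) (h_op a b j u x y z)
      - f x y z (v x y z) (h_op a b j v x y z)" for x y z
  obtain u2 where
    u2: "\<And>x y z. x \<in> ?X \<Longrightarrow> y \<in> ts_kappa ?Y \<Longrightarrow> z \<in> {a..b} \<Longrightarrow>
          has_delta_derivative ?Y (\<lambda>t. u x t z) (u2 x y z) y"
      "\<And>x y z. x \<in> ts_kappa ?X \<Longrightarrow> y \<in> ts_kappa ?Y \<Longrightarrow> z \<in> {a..b} \<Longrightarrow>
          has_delta_derivative ?X (\<lambda>s. u2 s y z) (f x y z (u x y z) (h_op a b j u x y z)) x"
    using u unfolding is_solution_def has_mixed_delta_derivative_def by metis
  obtain v2 where
    v2: "\<And>x y z. x \<in> ?X \<Longrightarrow> y \<in> ts_kappa ?Y \<Longrightarrow> z \<in> {a..b} \<Longrightarrow>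
          has_delta_derivative ?Y (\<lambda>t. v x t z) (v2 x y z) y"
      "\<And>x y z. x \<in> ts_kappa ?X \<Longrightarrow> y \<in> ts_kappa ?Y \<Longrightarrow> z \<in> {a..b} \<Longrightarrow>
          has_delta_derivative ?X (\<lambda>s. v2 s y z) (f x y z (v x y z) (h_op a b j v x y z)) x"
    using v unfolding is_solution_def has_mixed_delta_derivative_def by metis
  define w w2 where "w x y z = u x y z - v x y z" and "w2 x y z = u2 x y z - v2 x y z" for x y z
  have w_y: "has_delta_derivative ?Y (\<lambda>t. w x t z) (w2 x y z) y"
    if "x \<in> ?X" "y \<in> ts_kappa ?Y" "z \<in> {a..b}" for x y z
    unfolding w_def w2_def using that by (intro has_delta_derivative_diff u2 v2)
  have w2_x: "has_delta_derivative ?X (\<lambda>s. w2 s y z) (g x y z) x"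
    if "x \<in> ts_kappa ?X" "y \<in> ts_kappa ?Y" "z \<in> {a..b}" for x y z
    unfolding g_def w2_def using that by (intro has_delta_derivative_diff u2 v2)
  have w_y0: "w x y0 z = 0" if "x \<in> ?X" "z \<in> {a..b}" for x z
    using u v that by (simp add: is_solution_def w_def)
  have w_x0: "w x0 y z = 0" if "y \<in> ?Y" "z \<in> {a..b}" for y z
    using u v that by (simp add: is_solution_def w_def)
  \<comment> \<open>On the edge \<open>x = x0\<close> the function \<open>w\<close> is zero, so
    \<open>w2\<close> and 0 are both its delta derivatives in \<open>y\<close> and agree by
    uniqueness.\<close>
  have w2_x0: "w2 x0 y z = 0" if "y \<in> ts_kappa ?Y" "z \<in> {a..b}" for y z
  proof (rule has_delta_derivative_unique[OF _ _ that(1)])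
    have "x0 \<in> ?X" "y \<in> ?Y"
      using assms(3) that by (auto simp: ts_kappa_def)
    then show "has_delta_derivative ?Y (\<lambda>_. 0) (w2 x0 y z) y"
      using that by (intro has_delta_derivative_cong[OF closed(2) _ _ w_y]) (auto simp: w_x0)
    show "has_delta_derivative ?Y (\<lambda>_. 0) 0 y"
      unfolding has_delta_derivative_def by (auto intro: exI[of _ 1])
  qed

  \<comment> \<open>Uniform bounds and the Lipschitz constant\<close>
  obtain P1 where P1: "\<And>x y z. x \<in> C \<Longrightarrow> y \<in> D \<Longrightarrow> z \<in> {a..b} \<Longrightarrow> \<bar>p1 x y z\<bar> \<le> P1"
    using bounded[OF assms(13)] by auto
  obtain P2 where "\<And>x y w. x \<in> C \<Longrightarrow> y \<in> D \<Longrightarrow> w \<in> {a..b} \<times> {a..b} \<Longrightarrow>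
      \<bar>case w of (z, q) \<Rightarrow> p2 x y z q\<bar> \<le> P2"
    using bounded[OF assms(15) compact_Times[OF compact_Icc compact_Icc]] by metis
  from this[of _ _ "(_, _)"]
  have P2: "\<bar>p2 x y z q\<bar> \<le> P2" if "x \<in> C" "y \<in> D" "z \<in> {a..b}" "q \<in> {a..b}" for x y z q
    using that by simp
  obtain Ku where Ku: "\<And>x y z. x \<in> C \<Longrightarrow> y \<in> D \<Longrightarrow> z \<in> {a..b} \<Longrightarrow> \<bar>u x y z\<bar> \<le> Ku"
    using bounded[OF rd(1)] by auto
  obtain Kv where Kv: "\<And>x y z. x \<in> C \<Longrightarrow> y \<in> D \<Longrightarrow> z \<in> {a..b} \<Longrightarrow> \<bar>v x y z\<bar> \<le> Kv"
    using bounded[OF rd(2)] by auto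
  have corner: "x1 \<in> C" "y1 \<in> D"
    using x1 y1 by (auto simp: C_def D_def)
  have "0 \<le> P1" "0 \<le> P2"
    using P1[OF corner z1] P2[OF corner z1 z1] by auto

  \<comment> \<open>The 1 accounts for the difference of the solutions themselves,
    \<open>P2 * (b - a)\<close> for that of the integrals \<open>h_op\<close>.\<close>
  define M where "M = P1 * (1 + P2 * (b - a))"
  have "0 \<le> M"
    using \<open>0 \<le> P1\<close> \<open>0 \<le> P2\<close> \<open>a < b\<close> by (simp add: M_def)
  \<comment> \<open>\<open>K\<close> must bound the whole slice over \<open>q\<close> at fixed
    \<open>(x, y)\<close>, because \<open>h_op\<close> integrates over it.\<close>
  have g_bound: "\<bar>g x y z\<bar> \<le> M * K"
    if x: "x \<in> C" and y: "y \<in> D" and z: "z \<in> {a..b}"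
      and K: "\<And>q. q \<in> {a..b} \<Longrightarrow> \<bar>w x y q\<bar> \<le> K" for x y z K
  proof -
    have xy: "x \<in> ?X" "y \<in> ?Y"
      using x y sub by auto
    have "\<bar>h_op a b j u x y z - h_op a b j v x y z\<bar> \<le> P2 * K * (b - a)"
    proof (rule h_op_lipschitz[OF assms(9) rd xy z])
      fix q assume q: "q \<in> {a..b}"
      have "\<bar>j x y z q (u x y q) - j x y z q (v x y q)\<bar> \<le> p2 x y z q * \<bar>w x y q\<bar>"
        unfolding w_def by (rule j_lip[OF xy z q])
      also have "\<dots> \<le> P2 * K"
        using P2[OF x y z q] K[OF q] \<open>0 \<le> P2\<close> by (intro mult_mono) auto
      finally show "\<bar>j x y z q (u x y q) - j x y z q (v x y q)\<bar> \<le> P2 * K" .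
    qed
    then have "\<bar>w x y z\<bar> + \<bar>h_op a b j u x y z - h_op a b j v x y z\<bar> \<le> K + P2 * K * (b - a)"
      using K[OF z] by simp
    then have "p1 x y z * (\<bar>w x y z\<bar> + \<bar>h_op a b j u x y z - h_op a b j v x y z\<bar>)
        \<le> P1 * (K + P2 * K * (b - a))"
      using P1[OF x y z] \<open>0 \<le> P1\<close> by (intro mult_mono) auto
    moreover have "\<bar>g x y z\<bar> \<le> p1 x y z * (\<bar>w x y z\<bar> + \<bar>h_op a b j u x y z - h_op a b j v x y z\<bar>)"
      unfolding g_def w_def by (rule f_lip[OF xy z])
    ultimately show ?thesis
      by (simp add: M_def algebra_simps)
  qed

  \<comment> \<open>Contraction in an exponentially weighted bound\<close>
  define L where "L = M + 1"
  \<comment> \<open>With \<open>L = M + 1\<close> the square of \<open>L\<close> exceeds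
    \<open>M\<close>, so the contraction factor is below 1.\<close>
  have "M < M\<^sup>2 + 2 * M + 1"
    using \<open>0 \<le> M\<close> by (simp add: add_nonneg_pos add_strict_increasing)
  also have "\<dots> = L\<^sup>2"
    by (simp add: L_def power2_eq_square algebra_simps)
  finally have L: "0 < L" "M / L\<^sup>2 < 1"
    using \<open>0 \<le> M\<close> by (auto simp: L_def)
  have contract: "\<bar>w x y z\<bar> \<le> (M / L\<^sup>2 * K) * exp (L * (x + y))"
    if K: "\<And>x y z. x \<in> C \<Longrightarrow> y \<in> D \<Longrightarrow> z \<in> {a..b} \<Longrightarrow> \<bar>w x y z\<bar> \<le> K * exp (L * (x + y))"
      and "0 \<le> K" and x: "x \<in> C" and y: "y \<in> D" and z: "z \<in> {a..b}" for K x y z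
  proof -
    have MK: "0 \<le> M * K"
      using \<open>0 \<le> M\<close> \<open>0 \<le> K\<close> by simp
    \<comment> \<open>The first mean value bound runs in \<open>x\<close> from the edge where
      \<open>w2\<close> vanishes; the primitive of the increasing exponential brings a factor
      \<open>1 / L\<close>, and its nonnegative value at \<open>x0\<close> is dropped. Only
      \<open>t\<close> in \<open>ts_kappa ?Y\<close> is treated, where \<open>w2\<close> is a
      derivative.\<close>
    have w2_bound: "\<bar>w2 x t z\<bar> \<le> M * K / L * exp (L * (x + t))"
      if t: "t \<in> ts_kappa ?Y" "t \<le> y" for t
    proof -
      have "t \<in> D"
        using t y by (auto simp: D_def ts_kappa_def)
      have "\<bar>w2 x t z - w2 x0 t z\<bar>
          \<le> M * K / L * exp (L * (x + t)) - M * K / L * exp (L * (x0 + t))"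
      proof (rule delta_mean_value_bound[OF closed(1),
            where D = "\<lambda>s. g s t z" and p = "\<lambda>s. M * K * exp (L * (s + t))"])
        fix s assume s: "s \<in> ts_kappa ?X" "x0 \<le> s" "s \<le> x"
        then have "s \<in> C"
          using x by (auto simp: C_def ts_kappa_def)
        then have "\<bar>g s t z\<bar> \<le> M * (K * exp (L * (s + t)))"
          using \<open>t \<in> D\<close> z by (intro g_bound K)
        then show "\<bar>g s t z\<bar> \<le> M * K * exp (L * (s + t))"
          by (simp add: mult.assoc)
        show "has_delta_derivative ?X (\<lambda>s. w2 s t z) (g s t z) s"
          using s t z by (intro w2_x)
      next
        show "((\<lambda>s. M * K / L * exp (L * (s + t))) has_real_derivative M * K * exp (L * (s + t))) (at s)"
          for s
          using L(1) by (auto intro!: derivative_eq_intros)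
        show "mono (\<lambda>s. M * K * exp (L * (s + t)))"
          using L(1) MK by (intro monoI mult_left_mono) auto
      qed (use x assms(3) in \<open>auto simp: C_def\<close>)
      moreover have "0 \<le> M * K / L * exp (L * (x0 + t))"
        using MK L(1) by simp
      ultimately show ?thesis
        using w2_x0[OF t(1) z] by simp
    qed
    \<comment> \<open>The second bound runs in \<open>y\<close> from \<open>y0\<close>, where
      \<open>w\<close> vanishes, and brings another factor \<open>1 / L\<close>.\<close>
    have "\<bar>w x y z - w x y0 z\<bar>
        \<le> M * K / L\<^sup>2 * exp (L * (x + y)) - M * K / L\<^sup>2 * exp (L * (x + y0))"
    proof (rule delta_mean_value_bound[OF closed(2),
          where D = "\<lambda>t. w2 x t z" and p = "\<lambda>t. M * K / L * exp (L * (x + t))"])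
      fix t assume t: "t \<in> ts_kappa ?Y" "y0 \<le> t" "t \<le> y"
      show "has_delta_derivative ?Y (\<lambda>t. w x t z) (w2 x t z) t"
        using t x z sub by (intro w_y) auto
      show "\<bar>w2 x t z\<bar> \<le> M * K / L * exp (L * (x + t))"
        using t by (intro w2_bound)
    next
      show "((\<lambda>t. M * K / L\<^sup>2 * exp (L * (x + t))) has_real_derivative M * K / L * exp (L * (x + t))) (at t)"
        for t
        using L(1) by (auto intro!: derivative_eq_intros simp: power2_eq_square)
      show "mono (\<lambda>t. M * K / L * exp (L * (x + t)))"
        using L(1) MK by (intro monoI mult_left_mono) auto
    qed (use y assms(6) in \<open>auto simp: D_def\<close>)
    moreover have "0 \<le> M * K / L\<^sup>2 * exp (L * (x + y0))"
      using MK by simp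
    moreover have "w x y0 z = 0"
      using x z sub by (intro w_y0) auto
    ultimately show ?thesis
      by simp
  qed

  \<comment> \<open>Iteration of the contraction to zero\<close>
  define K0 where "K0 = (Ku + Kv) / exp (L * (x0 + y0))"
  have "0 \<le> Ku" "0 \<le> Kv"
    using Ku[OF corner z1] Kv[OF corner z1] by auto
  then have "0 \<le> K0"
    by (simp add: K0_def)
  have iterate: "\<bar>w x y z\<bar> \<le> ((M / L\<^sup>2) ^ n * K0) * exp (L * (x + y))"
    if "x \<in> C" "y \<in> D" "z \<in> {a..b}" for n x y z
    using that
  proof (induction n arbitrary: x y z)
    case 0
    \<comment> \<open>On the rectangle the weight is smallest at \<open>(x0, y0)\<close>; dividing
      by that value in \<open>K0\<close> makes the crude bound \<open>Ku + Kv\<close> a valid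
      start.\<close>
    have "exp (L * (x0 + y0)) \<le> exp (L * (x + y))"
      using 0 L(1) by (auto simp: C_def D_def)
    then have "K0 * exp (L * (x0 + y0)) \<le> K0 * exp (L * (x + y))"
      using \<open>0 \<le> K0\<close> by (rule mult_left_mono)
    moreover have "\<bar>w x y z\<bar> \<le> Ku + Kv"
      using Ku[OF 0] Kv[OF 0] unfolding w_def by linarith
    ultimately show ?case
      by (simp add: K0_def)
  next
    case (Suc n)
    have "0 \<le> (M / L\<^sup>2) ^ n * K0"
      using \<open>0 \<le> M\<close> \<open>0 \<le> K0\<close> by simp
    from contract[OF Suc.IH this Suc.prems] show ?case
      by (simp add: mult.assoc)
  qed
  \<comment> \<open>The geometric factor tends to 0 while the point stays fixed.\<close>
  have "(\<lambda>n. ((M / L\<^sup>2) ^ n * K0) * exp (L * (x1 + y1))) \<longlonglongrightarrow> (0 * K0) * exp (L * (x1 + y1))"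
    using L \<open>0 \<le> M\<close> by (intro tendsto_intros LIMSEQ_power_zero) auto
  then have "\<bar>w x1 y1 z1\<bar> \<le> (0 * K0) * exp (L * (x1 + y1))"
    by (rule LIMSEQ_le_const) (use iterate[OF corner z1] in blast)
  then show "u x1 y1 z1 = v x1 y1 z1"
    by (simp add: w_def)
qed

end
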